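(* Let $|\varphi_1\rangle,\dots,|\varphi_m\rangle\in\mathcal{H}_2$ be unit vectors with orthogonal unit vectors $|\varphi_l^\perp\rangle$, let $\mathcal{M}_l$ be the projective qubit measurement with effects $M_{l1}=|\varphi_l\rangle\langle\varphi_l|$, $M_{l2}=|\varphi_l^\perp\rangle\langle\varphi_l^\perp|$, and let $\eta_1,\dots,\eta_m\ge0$, $\sum_l\eta_l=1$, be prior probabilities. For every $p_f\in[0,1]$, the maximal success probability for discrimination of $\mathcal{M}_1,\dots,\mathcal{M}_m$ with fixed failure rate $p_f$ equals the maximal success probability for discrimination of the pure states $|\varphi_1\rangle,\dots,|\varphi_m\rangle$ (with the same priors) with fixed failure rate $p_f$. Moreover, this optimum for the measurements is attained by a test whose normalization is $\rho=\tfrac12 I$, i.e. by preparing a maximally entangled two-qubit state, measuring one qubit by the unknown measurement and then measuring the other qubit by a POVM depending on the obtained outcome.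
   Context: $\mathcal{H}_2$ is the two-dimensional complex Hilbert space. A (single-shot, general ancilla-assisted) test $\mathcal{T}$ with conclusions $c\in\{1,\dots,m,f\}$ ($f$ = inconclusive) is a family of positive semidefinite operators $H^{(c)}_j$ on $\mathcal{H}_2$, $j=1,2$, with $\sum_c H^{(c)}_j=\rho$ for $j=1,2$, where $\rho\ge0$, $\mathrm{tr}[\rho]=1$, independent of $j$, is called the normalization of the test. The conditional probability of conclusion $c$ for measurement $\mathcal{M}_l$ is $p(c|\mathcal{M}_l,\mathcal{T})=\sum_{j} \mathrm{tr}[H^{(c)}_jM_{lj}]$; the success and failure probabilities are $p_s=\sum_l\eta_l\,p(l|\mathcal{M}_l,\mathcal{T})$ and $p_f=\sum_l\eta_l\,p(f|\mathcal{M}_l,\mathcal{T})$. For the states, one uses a POVM $\{E_1,\dots,E_m,E_f\}$ on $\mathcal{H}_2$ and $p_s=\sum_l\eta_l\langle\varphi_l|E_l|\varphi_l\rangle$, $p_f=\sum_l\eta_l\langle\varphi_l|E_f|\varphi_l\rangle$. Discrimination with fixed failure rate $p_f$ means maximizing $p_s$ over all tests (respectively POVMs) whose failure probability equals $p_f$. Tests with $\rho=\tfrac12I$ correspond exactly to the experimental protocols whose probe is a maximally entangled two-qubit state. *)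

theory Defs
  imports "HOL-Analysis.Analysis"
begin

text \<open>
  The qubit space is \<open>complex ^ 2\<close>. Measurements are labelled by a finite type \<open>'m\<close>, conclusions by
  \<open>'m option\<close>, where \<open>None\<close> is the inconclusive result. Measurement outcomes are labelled by the
  type \<open>2\<close>, whose elements are \<open>1\<close> and \<open>2\<close> (with \<open>2 = 0\<close>).
\<close>

text \<open>The library's \<open>inner\<close> on \<open>complex ^ 'n\<close> is only the real part of the Hermitian inner product;
  its norm is the Hilbert space norm.\<close>

definition cinner :: "complex ^ 'n \<Rightarrow> complex ^ 'n \<Rightarrow> complex"
  where "cinner x y = (\<Sum>i\<in>UNIV. cnj (x $ i) * y $ i)"

definition ketbra :: "complex ^ 'n \<Rightarrow> complex ^ 'n \<Rightarrow> complex ^ 'n ^ 'n"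
  where "ketbra x y = (\<chi> i j. x $ i * cnj (y $ j))"

definition hermitian :: "complex ^ 'n ^ 'n \<Rightarrow> bool"
  where "hermitian A \<longleftrightarrow> (\<forall>i j. A $ i $ j = cnj (A $ j $ i))"

definition psd :: "complex ^ 'n ^ 'n \<Rightarrow> bool"
  where "psd A \<longleftrightarrow> hermitian A \<and> (\<forall>x. 0 \<le> Re (cinner x (A *v x)))"

definition povm :: "('c::finite \<Rightarrow> complex ^ 'n ^ 'n) \<Rightarrow> bool"
  where "povm E \<longleftrightarrow> (\<forall>c. psd (E c)) \<and> (\<Sum>c\<in>UNIV. E c) = mat 1"

text \<open>\<open>H c j\<close> is the operator for conclusion \<open>c\<close> and outcome \<open>j\<close>; the second argument is the
  normalization of the test.\<close>

definition test_with_normalization ::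
    "('c::finite \<Rightarrow> 2 \<Rightarrow> complex ^ 2 ^ 2) \<Rightarrow> complex ^ 2 ^ 2 \<Rightarrow> bool"
  where "test_with_normalization H \<rho> \<longleftrightarrow>
    (\<forall>c j. psd (H c j)) \<and> psd \<rho> \<and> trace \<rho> = 1 \<and> (\<forall>j. (\<Sum>c\<in>UNIV. H c j) = \<rho>)"

definition is_test :: "('c::finite \<Rightarrow> 2 \<Rightarrow> complex ^ 2 ^ 2) \<Rightarrow> bool"
  where "is_test H \<longleftrightarrow> (\<exists>\<rho>. test_with_normalization H \<rho>)"

definition projective_measurement :: "complex ^ 2 \<Rightarrow> complex ^ 2 \<Rightarrow> 2 \<Rightarrow> complex ^ 2 ^ 2"
  where "projective_measurement x y j = (if j = 1 then ketbra x x else ketbra y y)"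

text \<open>The traces and expectation values below are real for positive semidefinite operators, so that
  taking real parts only adjusts the type.\<close>

definition test_prob ::
    "('c \<Rightarrow> 2 \<Rightarrow> complex ^ 2 ^ 2) \<Rightarrow> (2 \<Rightarrow> complex ^ 2 ^ 2) \<Rightarrow> 'c \<Rightarrow> real"
  where "test_prob H M c = Re (\<Sum>j\<in>UNIV. trace (H c j ** M j))"

definition test_success ::
    "('m::finite \<Rightarrow> real) \<Rightarrow> ('m \<Rightarrow> 2 \<Rightarrow> complex ^ 2 ^ 2) \<Rightarrow>
     ('m option \<Rightarrow> 2 \<Rightarrow> complex ^ 2 ^ 2) \<Rightarrow> real"
  where "test_success \<eta> M H = (\<Sum>l\<in>UNIV. \<eta> l * test_prob H (M l) (Some l))"

definition test_failure ::
    "('m::finite \<Rightarrow> real) \<Rightarrow> ('m \<Rightarrow> 2 \<Rightarrow> complex ^ 2 ^ 2) \<Rightarrow>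
     ('m option \<Rightarrow> 2 \<Rightarrow> complex ^ 2 ^ 2) \<Rightarrow> real"
  where "test_failure \<eta> M H = (\<Sum>l\<in>UNIV. \<eta> l * test_prob H (M l) None)"

definition state_success ::
    "('m::finite \<Rightarrow> real) \<Rightarrow> ('m \<Rightarrow> complex ^ 2) \<Rightarrow> ('m option \<Rightarrow> complex ^ 2 ^ 2) \<Rightarrow> real"
  where "state_success \<eta> \<phi> E = (\<Sum>l\<in>UNIV. \<eta> l * Re (cinner (\<phi> l) (E (Some l) *v \<phi> l)))"

definition state_failure ::
    "('m::finite \<Rightarrow> real) \<Rightarrow> ('m \<Rightarrow> complex ^ 2) \<Rightarrow> ('m option \<Rightarrow> complex ^ 2 ^ 2) \<Rightarrow> real"
  where "state_failure \<eta> \<phi> E = (\<Sum>l\<in>UNIV. \<eta> l * Re (cinner (\<phi> l) (E None *v \<phi> l)))"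

definition optimal_test ::
    "('m::finite \<Rightarrow> real) \<Rightarrow> ('m \<Rightarrow> 2 \<Rightarrow> complex ^ 2 ^ 2) \<Rightarrow> real \<Rightarrow>
     ('m option \<Rightarrow> 2 \<Rightarrow> complex ^ 2 ^ 2) \<Rightarrow> bool"
  where "optimal_test \<eta> M pf = is_arg_max (test_success \<eta> M) (\<lambda>H. is_test H \<and> test_failure \<eta> M H = pf)"

definition optimal_povm ::
    "('m::finite \<Rightarrow> real) \<Rightarrow> ('m \<Rightarrow> complex ^ 2) \<Rightarrow> real \<Rightarrow> ('m option \<Rightarrow> complex ^ 2 ^ 2) \<Rightarrow> bool"
  where "optimal_povm \<eta> \<phi> pf = is_arg_max (state_success \<eta> \<phi>) (\<lambda>E. povm E \<and> state_failure \<eta> \<phi> E = pf)"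

text \<open>Two qubits: the tensor product of two copies of \<open>complex ^ 2\<close> is \<open>complex ^ (2 \<times> 2)\<close>, and
  \<open>tensor_op A B\<close> is the Kronecker product.\<close>

definition tensor_op :: "complex ^ 2 ^ 2 \<Rightarrow> complex ^ 2 ^ 2 \<Rightarrow> complex ^ (2 \<times> 2) ^ (2 \<times> 2)"
  where "tensor_op A B = (\<chi> r s. A $ fst r $ fst s * B $ snd r $ snd s)"

text \<open>Unit vectors both of whose reduced states (partial traces of the projector) are maximally
  mixed.\<close>

definition maximally_entangled :: "complex ^ (2 \<times> 2) \<Rightarrow> bool"
  where "maximally_entangled \<psi> \<longleftrightarrow> norm \<psi> = 1 \<and>
    (\<chi> i k. \<Sum>j\<in>UNIV. \<psi> $ (i, j) * cnj (\<psi> $ (k, j))) = (1 / 2) *\<^sub>R (mat 1 :: complex ^ 2 ^ 2) \<and>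
    (\<chi> i k. \<Sum>j\<in>UNIV. \<psi> $ (j, i) * cnj (\<psi> $ (j, k))) = (1 / 2) *\<^sub>R (mat 1 :: complex ^ 2 ^ 2)"

text \<open>The experiment: prepare \<open>\<psi>\<close>, measure its first qubit, and after outcome \<open>j\<close> measure the second
  qubit by the POVM \<open>F j\<close>. It implements \<open>H\<close> if, for every effect \<open>M\<close> belonging to outcome \<open>j\<close>, the
  probability of obtaining \<open>j\<close> and then \<open>c\<close> is the one that \<open>H\<close> assigns (both sides are linear in
  \<open>M\<close>, so \<open>M\<close> may range over all operators).\<close>

definition implemented_by ::
    "('c::finite \<Rightarrow> 2 \<Rightarrow> complex ^ 2 ^ 2) \<Rightarrow> complex ^ (2 \<times> 2) \<Rightarrow>
     (2 \<Rightarrow> 'c \<Rightarrow> complex ^ 2 ^ 2) \<Rightarrow> bool"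
  where "implemented_by H \<psi> F \<longleftrightarrow> (\<forall>j. povm (F j)) \<and>
    (\<forall>c j M. cinner \<psi> (tensor_op M (F j c) *v \<psi>) = trace (H c j ** M))"

end

theory Submission
  imports Defs
begin

text \<open>
  For a qubit operator \<open>A\<close> let \<open>A\<^sup>~ = tr A \<cdot> I - A\<close> be its spin flip. This map is linear,
  preserves positivity, is self-adjoint for the trace pairing, and exchanges the projectors onto
  \<open>\<phi>\<close> and \<open>\<phi>\<^sup>\<bottom>\<close>. Hence
  \<open>tr (H\<^sub>1 |\<phi>\<rangle>\<langle>\<phi>|) + tr (H\<^sub>2 |\<phi>\<^sup>\<bottom>\<rangle>\<langle>\<phi>\<^sup>\<bottom>|) = \<langle>\<phi>| H\<^sub>1 + H\<^sub>2\<^sup>~ |\<phi>\<rangle>\<close>, and the operators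
  \<open>H\<^sub>1 + H\<^sub>2\<^sup>~\<close> form a POVM because \<open>\<rho> + \<rho>\<^sup>~ = I\<close>. So every test yields a POVM with the same
  success and failure probabilities. Conversely a POVM \<open>E\<close> yields the test \<open>(E / 2, E\<^sup>~ / 2)\<close>
  with normalization \<open>I / 2\<close>. An optimal POVM exists by compactness. The spin flip is also what a
  singlet pair induces: \<open>\<langle>\<psi>| M \<otimes> F |\<psi>\<rangle> = tr (F\<^sup>~ M) / 2\<close>.
\<close>

section \<open>Algebra and positivity of the spin flip\<close>

definition spin_flip :: "complex ^ 2 ^ 2 \<Rightarrow> complex ^ 2 ^ 2"
  where "spin_flip A = mat (trace A) - A"

lemma trace_2: "trace (A :: 'a::semiring_1 ^ 2 ^ 2) = A $ 1 $ 1 + A $ 2 $ 2"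
  by (simp add: trace_def sum_2)

lemma spin_flip_nth [simp]:
  "spin_flip A $ 1 $ 1 = A $ 2 $ 2" "spin_flip A $ 1 $ 2 = - (A $ 1 $ 2)"
  "spin_flip A $ 2 $ 1 = - (A $ 2 $ 1)" "spin_flip A $ 2 $ 2 = A $ 1 $ 1"
  by (simp_all add: spin_flip_def trace_2 mat_def)

lemma linear_spin_flip: "linear spin_flip"
  by (rule linearI) (simp_all add: vec_eq_iff forall_2)

lemma spin_flip_spin_flip [simp]: "spin_flip (spin_flip A) = A"
  by (simp add: vec_eq_iff forall_2)

lemma trace_spin_flip_mult: "trace (spin_flip A ** B) = trace (A ** spin_flip B)"
  by (simp add: trace_2 matrix_matrix_mult_def sum_2 algebra_simps)

lemma add_spin_flip: "A + spin_flip A = mat (trace A)"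
  by (simp add: spin_flip_def)

text \<open>Unlike the defining equation, this orientation terminates as a rewrite rule.\<close>

lemma hermitian_iff_cnj: "hermitian A \<longleftrightarrow> (\<forall>i j. cnj (A $ j $ i) = A $ i $ j)"
  unfolding hermitian_def by metis

text \<open>The quadratic form of \<open>spin_flip A\<close> at \<open>x\<close> is that of
  \<open>A\<close> at the conjugated vector \<open>(cnj x2, - cnj x1)\<close>, which is orthogonal
  to \<open>x\<close>.\<close>

lemma psd_spin_flip:
  assumes "psd A"
  shows "psd (spin_flip A)"
proof -
  have "cinner x (spin_flip A *v x) =
      cinner (vector [cnj (x $ 2), - cnj (x $ 1)]) (A *v vector [cnj (x $ 2), - cnj (x $ 1)])" for x
    by (simp add: cinner_def matrix_vector_mult_def sum_2 algebra_simps)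
  moreover have "hermitian (spin_flip A)"
    using assms by (simp add: psd_def hermitian_iff_cnj forall_2)
  ultimately show ?thesis
    using assms by (simp add: psd_def)
qed

lemma psd_add: "psd A \<Longrightarrow> psd B \<Longrightarrow> psd (A + B)"
  by (simp add: psd_def hermitian_iff_cnj cinner_def matrix_vector_mult_def
      distrib_left distrib_right sum.distrib)

lemma cinner_scaleR_mult: "cinner x ((r *\<^sub>R A) *v x) = r *\<^sub>R cinner x (A *v x)"
  by (simp add: cinner_def matrix_vector_mult_def flip: scaleR_sum_right)

lemma psd_scaleR: "psd A \<Longrightarrow> 0 \<le> r \<Longrightarrow> psd (r *\<^sub>R A)"
  by (simp add: psd_def cinner_scaleR_mult) (simp add: hermitian_iff_cnj)

lemma cinner_self: "cinner x x = of_real ((norm x)\<^sup>2)"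
  by (simp add: cinner_def norm_vec_def L2_set_def sum_nonneg mult.commute
      flip: complex_norm_square)

lemma psd_mat_1: "psd (mat 1)"
  by (simp add: psd_def cinner_self) (simp add: hermitian_iff_cnj mat_def)

lemma cinner_mult_eq_trace: "cinner x (A *v x) = trace (A ** ketbra x x)"
  by (simp add: cinner_def matrix_vector_mult_def trace_def matrix_matrix_mult_def ketbra_def
      sum_distrib_left algebra_simps)

lemma ketbra_orthonormal_sum:
  fixes x y :: "complex ^ 2"
  assumes "norm x = 1" "norm y = 1" "cinner x y = 0"
  shows "ketbra x x + ketbra y y = mat 1"
proof -
  \<comment> \<open>\<open>B\<close> has columns \<open>x\<close>, \<open>y\<close> and
    \<open>A\<close> is its adjoint, so \<open>A ** B\<close> is the Gram matrix of the pair and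
    \<open>B ** A\<close> the sum of the two projectors.\<close>
  define A :: "complex ^ 2 ^ 2" where "A = (\<chi> i j. cnj ((if i = 1 then x else y) $ j))"
  define B :: "complex ^ 2 ^ 2" where "B = (\<chi> i j. (if j = 1 then x else y) $ i)"
  have "cinner x x = 1" "cinner y y = 1"
    using assms by (simp_all add: cinner_self)
  moreover have "cinner y x = cnj (cinner x y)"
    by (simp add: cinner_def mult.commute)
  moreover have "A ** B = (\<chi> i j. cinner (if i = 1 then x else y) (if j = 1 then x else y))"
    by (simp add: A_def B_def matrix_matrix_mult_def cinner_def)
  ultimately have "A ** B = mat 1"
    using assms(3) by (simp add: vec_eq_iff forall_2 mat_def)
  \<comment> \<open>Orthonormal columns of a square matrix force orthonormal rows.\<close>
  then have "B ** A = mat 1"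
    by (simp add: matrix_left_right_inverse)
  moreover have "B ** A = ketbra x x + ketbra y y"
    by (simp add: A_def B_def matrix_matrix_mult_def ketbra_def vec_eq_iff sum_2)
  ultimately show ?thesis by simp
qed

lemma spin_flip_ketbra:
  assumes "norm x = 1" "norm y = 1" "cinner x y = 0"
  shows "spin_flip (ketbra x x) = ketbra y y"
proof -
  have "trace (ketbra x x) = cinner x x"
    by (simp add: trace_def ketbra_def cinner_def mult.commute)
  then have "trace (ketbra x x) = 1"
    using assms(1) by (simp add: cinner_self)
  then show ?thesis
    using ketbra_orthonormal_sum[OF assms] by (simp add: spin_flip_def algebra_simps)
qed

lemma matrix_mult_add_rdistrib: "(A + B) ** C = A ** C + B ** (C :: 'a::semiring_1 ^ 'n ^ 'm)"
  by (simp add: matrix_matrix_mult_def vec_eq_iff distrib_right sum.distrib)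

section \<open>Translation between tests and POVMs\<close>

lemma test_prob_projective:
  assumes "norm x = 1" "norm y = 1" "cinner x y = 0"
  shows "test_prob H (projective_measurement x y) c =
    Re (cinner x ((H c 1 + spin_flip (H c 2)) *v x))"
  using spin_flip_ketbra[OF assms]
  by (simp add: test_prob_def projective_measurement_def sum_2 cinner_mult_eq_trace
      matrix_mult_add_rdistrib trace_add trace_spin_flip_mult)

lemma povm_of_test:
  assumes "is_test H"
  shows "povm (\<lambda>c. H c 1 + spin_flip (H c 2))"
proof -
  obtain \<rho> where \<rho>: "test_with_normalization H \<rho>"
    using assms by (auto simp: is_test_def)
  have "(\<Sum>c\<in>UNIV. H c 1 + spin_flip (H c 2)) = \<rho> + spin_flip \<rho>"
    using \<rho> by (simp add: test_with_normalization_def sum.distrib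
        flip: linear_sum[OF linear_spin_flip])
  then show ?thesis
    using \<rho> by (simp add: povm_def test_with_normalization_def add_spin_flip psd_add psd_spin_flip)
qed

text \<open>A right inverse of the passage from tests to POVMs: since the spin flip is an
  involution, each outcome contributes one half of \<open>E c\<close>.\<close>

definition test_of_povm :: "('c \<Rightarrow> complex ^ 2 ^ 2) \<Rightarrow> 'c \<Rightarrow> 2 \<Rightarrow> complex ^ 2 ^ 2"
  where "test_of_povm E c j = (1 / 2) *\<^sub>R (if j = 1 then E c else spin_flip (E c))"

lemma spin_flip_mat_1: "spin_flip (mat 1) = mat 1"
  by (simp add: vec_eq_iff forall_2) (simp add: mat_def)

lemma povm_spin_flip: "povm E \<Longrightarrow> povm (\<lambda>c. spin_flip (E c))"
  by (simp add: povm_def psd_spin_flip spin_flip_mat_1 flip: linear_sum[OF linear_spin_flip])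

lemma test_with_normalization_test_of_povm:
  assumes "povm E"
  shows "test_with_normalization (test_of_povm E) ((1 / 2) *\<^sub>R mat 1)"
proof -
  have "(\<Sum>c\<in>UNIV. test_of_povm E c j) = (1 / 2) *\<^sub>R mat 1" for j
    using assms povm_spin_flip[OF assms]
    by (cases "j = 1") (simp_all add: test_of_povm_def povm_def flip: scaleR_sum_right)
  moreover have "trace ((1 / 2) *\<^sub>R mat 1 :: complex ^ 2 ^ 2) = 1"
    by (simp add: trace_2 mat_def scaleR_conv_of_real[where 'a = complex])
  moreover have "psd (test_of_povm E c j)" for c j
    using assms by (simp add: test_of_povm_def povm_def psd_scaleR psd_spin_flip)
  ultimately show ?thesis
    by (simp add: test_with_normalization_def psd_scaleR psd_mat_1)
qed

lemma povm_of_test_of_povm: "test_of_povm E c 1 + spin_flip (test_of_povm E c 2) = E c"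
  by (simp add: test_of_povm_def linear_scale[OF linear_spin_flip] flip: scaleR_add_left)

section \<open>Realization with a singlet pair\<close>

definition singlet :: "complex ^ (2 \<times> 2)"
  where "singlet = (\<chi> r. if r = (1, 2) then 1 / sqrt 2 else if r = (2, 1) then - 1 / sqrt 2 else 0)"

lemma sum_2_times_2:
  "(\<Sum>r\<in>UNIV. f r) = f (1, 1) + f (1, 2) + f (2, 1) + f (2, 2)" for f :: "2 \<times> 2 \<Rightarrow> 'a::comm_monoid_add"
proof -
  have "(\<Sum>r\<in>UNIV. f r) = (\<Sum>i\<in>UNIV. \<Sum>j\<in>UNIV. f (i, j))"
    by (simp add: sum.cartesian_product flip: UNIV_Times_UNIV)
  then show ?thesis
    by (simp add: sum_2 add.assoc)
qed

lemma of_real_sqrt_2_square: "complex_of_real (sqrt 2) * complex_of_real (sqrt 2) = 2"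
  by (simp flip: of_real_mult)

lemma maximally_entangled_singlet: "maximally_entangled singlet"
proof -
  have "norm singlet = 1"
    by (simp add: norm_vec_def L2_set_def sum_2_times_2 singlet_def norm_divide power_divide)
  then show ?thesis
    by (simp add: maximally_entangled_def)
      (simp add: singlet_def vec_eq_iff forall_2 sum_2 mat_def of_real_sqrt_2_square
        scaleR_conv_of_real[where 'a = complex])
qed

lemma cinner_singlet_tensor_op:
  "cinner singlet (tensor_op A B *v singlet) = (1 / 2) * trace (spin_flip B ** A)"
  by (simp add: cinner_def matrix_vector_mult_def tensor_op_def singlet_def sum_2_times_2
      trace_2 matrix_matrix_mult_def sum_2 of_real_sqrt_2_square field_simps)

text \<open>The singlet turns an effect of the second qubit into half its spin flip. The POVM for
  each outcome is therefore the spin flip of twice the test operator, which for outcome 2 gives back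
  \<open>E\<close>.\<close>

lemma implemented_by_singlet:
  assumes "povm E"
  shows "implemented_by (test_of_povm E) singlet
    (\<lambda>j c. if j = 1 then spin_flip (E c) else E c)"
proof -
  have "trace (((1 / 2) *\<^sub>R B) ** A) = (1 / 2) * trace (B ** A)" for A B :: "complex ^ 2 ^ 2"
    by (simp add: trace_2 matrix_matrix_mult_def sum_2 scaleR_conv_of_real[where 'a = complex]
        algebra_simps)
  then show ?thesis
    using assms povm_spin_flip[OF assms]
    by (simp add: implemented_by_def forall_2 cinner_singlet_tensor_op test_of_povm_def)
qed

section \<open>Existence of an optimal POVM by compactness\<close>

text \<open>Positivity at the basis vectors handles the diagonal. The vectors (1, 1) and (1, -1)
  bound the real part of the off-diagonal entry by half the trace, and (1, \<i>) and (1, -\<i>) its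
  imaginary part.\<close>

lemma norm_psd_nth_le_trace:
  fixes A :: "complex ^ 2 ^ 2"
  assumes "psd A"
  shows "norm (A $ i $ j) \<le> Re (trace A)"
proof -
  have h: "A $ i $ j = cnj (A $ j $ i)" for i j
    using assms by (simp add: psd_def hermitian_iff_cnj)
  have im: "Im (A $ i $ i) = 0" for i
    using arg_cong[OF h[of i i], of Im] by simp
  have pos: "0 \<le> Re (cinner (vector [z, w]) (A *v vector [z, w]))" for z w
    using assms by (simp add: psd_def)
  have "0 \<le> Re (A $ 1 $ 1)" "0 \<le> Re (A $ 2 $ 2)"
    using pos[of 1 0] pos[of 0 1] by (simp_all add: cinner_def matrix_vector_mult_def sum_2)
  moreover have "\<bar>Re (A $ 1 $ 2)\<bar> \<le> Re (trace A) / 2"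
    using pos[of 1 1] pos[of 1 "-1"] h[of 2 1]
    by (simp add: cinner_def matrix_vector_mult_def sum_2 trace_2)
  moreover have "\<bar>Im (A $ 1 $ 2)\<bar> \<le> Re (trace A) / 2"
    using pos[of 1 \<i>] pos[of 1 "-\<i>"] h[of 2 1]
    by (simp add: cinner_def matrix_vector_mult_def sum_2 trace_2)
  ultimately have "\<bar>Re (A $ i $ j)\<bar> + \<bar>Im (A $ i $ j)\<bar> \<le> Re (trace A)"
    using im h[of 2 1] exhaust_2[of i] exhaust_2[of j] by (auto simp: trace_2)
  then show ?thesis
    using cmod_le[of "A $ i $ j"] by linarith
qed

lemma norm_vec_le_sum: "norm x \<le> (\<Sum>i\<in>UNIV. norm (x $ i))"
  by (simp add: norm_vec_def L2_set_le_sum)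

text \<open>The traces of the effects are nonnegative and add up to 2, so each of the four entries
  of an effect has modulus at most 2.\<close>

lemma norm_povm_le:
  fixes E :: "'c::finite \<Rightarrow> complex ^ 2 ^ 2"
  assumes "povm E"
  shows "norm (E c) \<le> 8"
proof -
  have psd: "psd (E c)" for c
    using assms by (simp add: povm_def)
  have "Re (trace (E c)) \<le> (\<Sum>c\<in>UNIV. Re (trace (E c)))"
    using norm_psd_nth_le_trace[OF psd]
    by (intro member_le_sum) (auto intro: order_trans[OF norm_ge_zero])
  also have "\<dots> = Re (trace (\<Sum>c\<in>UNIV. E c))"
    by (simp add: trace_2 sum.distrib)
  also have "\<dots> = 2"
    using assms by (simp add: povm_def trace_2 mat_def)
  finally have "norm (E c $ i $ j) \<le> 2" for i j
    using norm_psd_nth_le_trace[OF psd] by (rule order_trans[rotated])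
  moreover have "norm (E c) \<le> (\<Sum>i\<in>UNIV. \<Sum>j\<in>UNIV. norm (E c $ i $ j))"
    by (rule order_trans[OF norm_vec_le_sum sum_mono[OF norm_vec_le_sum]])
  ultimately show ?thesis
    by (simp add: sum_2) (smt (verit))
qed

lemma continuous_on_cinner_mult:
  assumes "continuous_on S A"
  shows "continuous_on S (\<lambda>v. cinner x (A v *v x))"
  unfolding cinner_def matrix_vector_mult_def using assms by (auto intro!: continuous_intros)

lemma closed_psd: "closed {v. psd (v $ c :: complex ^ 'n ^ 'n)}"
  unfolding psd_def hermitian_def
  by (intro closed_Collect_conj closed_Collect_all closed_Collect_eq closed_Collect_le
      continuous_intros continuous_on_cinner_mult)

text \<open>POVMs are coded as vectors indexed by conclusions, so that they lie in a Euclidean space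
  where closed and bounded sets are compact.\<close>

lemma compact_povms:
  fixes \<phi> :: "'m::finite \<Rightarrow> complex ^ 2"
  shows "compact {v :: complex ^ 2 ^ 2 ^ ('m option). povm (($) v) \<and> state_failure \<eta> \<phi> (($) v) = pf}"
    (is "compact ?S")
proof -
  have "closed ?S"
    unfolding povm_def state_failure_def
    by (intro closed_Collect_conj closed_Collect_all closed_psd closed_Collect_eq
        continuous_intros continuous_on_cinner_mult)
  moreover have "bounded ?S"
  proof (rule boundedI)
    fix v :: "complex ^ 2 ^ 2 ^ ('m option)" assume "v \<in> ?S"
    then have "norm (v $ c) \<le> 8" for c
      using norm_povm_le by blast
    then show "norm v \<le> (\<Sum>c\<in>(UNIV :: 'm option set). 8)"
      by (rule order_trans[OF norm_vec_le_sum sum_mono])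
  qed
  ultimately show ?thesis
    by (simp add: compact_eq_bounded_closed)
qed

lemma optimal_povm_exists:
  fixes \<phi> :: "'m::finite \<Rightarrow> complex ^ 2"
  assumes "\<And>l. norm (\<phi> l) = 1" "(\<Sum>l\<in>UNIV. \<eta> l) = 1" "0 \<le> pf" "pf \<le> 1"
  shows "\<exists>E. optimal_povm \<eta> \<phi> pf E"
proof -
  let ?S = "{v :: complex ^ 2 ^ 2 ^ ('m option). povm (($) v) \<and> state_failure \<eta> \<phi> (($) v) = pf}"
  \<comment> \<open>A feasible point: fail with probability \<open>pf\<close> whatever the state,
    and otherwise always guess one arbitrary label, here \<open>undefined\<close>.\<close>
  define E :: "'m option \<Rightarrow> complex ^ 2 ^ 2" where
    "E c = (case c of None \<Rightarrow> pf *\<^sub>R mat 1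
      | Some l \<Rightarrow> if l = undefined then (1 - pf) *\<^sub>R mat 1 else 0)" for c
  have "(\<Sum>c\<in>UNIV. E c) = mat 1"
    by (simp add: E_def UNIV_option_conv sum.reindex flip: scaleR_add_left)
  moreover have "psd (E c)" for c
    \<comment> \<open>The factor 0 yields positivity of the zero operator, the effect of every other
      label.\<close>
    using assms psd_scaleR[OF psd_mat_1, of 0]
    by (auto simp: E_def psd_scaleR psd_mat_1 split: option.split)
  moreover have "state_failure \<eta> \<phi> E = pf"
    using assms by (simp add: state_failure_def E_def cinner_scaleR_mult cinner_self
        flip: sum_distrib_right)
  ultimately have "vec_lambda E \<in> ?S"
    by (simp add: povm_def vec_lambda_inverse)
  then have "?S \<noteq> {}" by blast
  moreover have "continuous_on ?S (\<lambda>v. state_success \<eta> \<phi> (($) v))"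
    unfolding state_success_def by (intro continuous_intros continuous_on_cinner_mult)
  ultimately obtain v where v: "v \<in> ?S"
    and max: "\<And>w. w \<in> ?S \<Longrightarrow> state_success \<eta> \<phi> (($) w) \<le> state_success \<eta> \<phi> (($) v)"
    using continuous_attains_sup[OF compact_povms] by blast
  have "state_success \<eta> \<phi> F \<le> state_success \<eta> \<phi> (($) v)"
    if "povm F" "state_failure \<eta> \<phi> F = pf" for F
    using max[of "vec_lambda F"] that by (simp add: vec_lambda_inverse)
  then have "optimal_povm \<eta> \<phi> pf (($) v)"
    using v by (auto simp: optimal_povm_def is_arg_max_def not_less)
  then show ?thesis by blast
qed

theorem mainTheorem5:
  fixes \<phi> \<phi>' :: "'m::finite \<Rightarrow> complex ^ 2"
    and \<eta> :: "'m \<Rightarrow> real"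
    and M :: "'m \<Rightarrow> 2 \<Rightarrow> complex ^ 2 ^ 2"
    and pf :: real
  assumes "\<And>l. norm (\<phi> l) = 1"
    and "\<And>l. norm (\<phi>' l) = 1"
    and "\<And>l. cinner (\<phi> l) (\<phi>' l) = 0"
    and "\<And>l. M l = projective_measurement (\<phi> l) (\<phi>' l)"
    and "\<And>l. 0 \<le> \<eta> l"
    and "(\<Sum>l\<in>UNIV. \<eta> l) = 1"
    and "0 \<le> pf" and "pf \<le> 1"
  shows "\<exists>H E. optimal_test \<eta> M pf H \<and> optimal_povm \<eta> \<phi> pf E \<and>
    test_success \<eta> M H = state_success \<eta> \<phi> E \<and>
    test_with_normalization H ((1 / 2) *\<^sub>R mat 1) \<and>
    (\<exists>\<psi> F. maximally_entangled \<psi> \<and> implemented_by H \<psi> F)"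
proof -
  define P where "P H c = H c 1 + spin_flip (H c 2)"
    for H :: "'m option \<Rightarrow> 2 \<Rightarrow> complex ^ 2 ^ 2" and c
  have succ: "test_success \<eta> M H = state_success \<eta> \<phi> (P H)" for H
    using assms(1-4) by (simp add: test_success_def state_success_def test_prob_projective P_def)
  have fail: "test_failure \<eta> M H = state_failure \<eta> \<phi> (P H)" for H
    using assms(1-4) by (simp add: test_failure_def state_failure_def test_prob_projective P_def)
  have povm: "povm (P H)" if "is_test H" for H
    using povm_of_test[OF that] by (simp add: P_def[abs_def])
  obtain E where E: "optimal_povm \<eta> \<phi> pf E"
    using optimal_povm_exists assms(1,6-8) by blast
  then have "povm E"
    by (simp add: optimal_povm_def is_arg_max_def)
  have P: "P (test_of_povm E) = E"
    by (rule ext) (simp add: P_def povm_of_test_of_povm)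
  have test: "test_with_normalization (test_of_povm E) ((1 / 2) *\<^sub>R mat 1)"
    using \<open>povm E\<close> by (rule test_with_normalization_test_of_povm)
  then have "is_test (test_of_povm E)"
    by (auto simp: is_test_def)
  \<comment> \<open>A competing test \<open>H\<close> gives the POVM \<open>P H\<close> with the
    same failure and success probabilities, so it cannot beat \<open>E\<close>, whose values
    \<open>test_of_povm E\<close> reproduces.\<close>
  then have "optimal_test \<eta> M pf (test_of_povm E)"
    using E povm by (auto simp: optimal_test_def optimal_povm_def is_arg_max_def succ fail P)
  moreover have "test_success \<eta> M (test_of_povm E) = state_success \<eta> \<phi> E"
    by (simp add: succ P)
  ultimately show ?thesis
    using E test maximally_entangled_singlet implemented_by_singlet[OF \<open>povm E\<close>] by blast
qed

end
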